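(* Let $R$ be a ring, $\sigma$ an automorphism of $R$, $\delta$ a locally nilpotent $\sigma$-derivation of $R$, and $A=R(x;\sigma,\delta)$ the skew Ore polynomial ring. Let $M_R$ be a right $R$-module. If $N_R$ is a uniform submodule of $M_R$, then $N[x^{-1}]_A$ is a uniform submodule of the right $A$-module $M[x^{-1}]_A$.
   Context: Rings are associative with identity, not necessarily commutative; modules are right modules. A $\sigma$-derivation of $R$ is an additive map $\delta:R\to R$ with $\delta(rs)=\sigma(r)\delta(s)+\delta(r)s$ for all $r,s\in R$. It is locally nilpotent if for every $r\in R$ there is $n(r)\ge 1$ with $\delta^{n(r)}(r)=0$. Skew Ore polynomial ring: $A=R(x;\sigma,\delta)$ is the (associative) ring containing $R$ and an element $x$, whose elements are uniquely representable as $r_0+r_1x+\cdots+r_kx^k$ with $r_i\in R$, $k\in\mathbb N$, and with commutation rule $xr=\sigma(r)x+x\delta(r)x$ for all $r\in R$; equivalently $xr=\sigma(r)x+\sigma\delta(r)x^2+\cdots+\sigma\delta^{n(r)-1}(r)x^{n(r)}$. That these data define such a ring $A$ is part of the setting. Inverse polynomial module: put $\sigma'=\sigma^{-1}$ and $\delta'=-\delta\sigma^{-1}$. For $0\le i\le k$ let $f_k^i:R\to R$ be the sum of all words (compositions) in $\sigma',\delta'$ with $i$ letters $\sigma'$ and $k-i$ letters $\delta'$ ($f_0^0=\mathrm{id}$). For a right $R$-module $M_R$, $M[x^{-1}]$ is the additive group of formal polynomials $m_0+m_1x^{-1}+\cdots+m_kx^{-k}$, $m_i\in M$, $k\in\mathbb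 N$. It is a right $A$-module via $(mx^{-k})r=\sum_{i=0}^k m f_k^i(r)x^{-i}$ for $r\in R$ (the iteration of $mx^{-1}r=m\sigma'(r)x^{-1}+m\delta'(r)$) and $(mx^{-i})x^j=mx^{-i+j}$ if $j\le i$ and $0$ if $j>i$. For a submodule $N_R\subseteq M_R$, $N[x^{-1}]_A$ is the $A$-submodule of polynomials with all coefficients in $N$. A non-zero module is uniform if the intersection of any two of its non-zero submodules is non-zero. *)

theory Defs
  imports Complex_Main "HOL-Computational_Algebra.Polynomial"
begin

text \<open>
  The sort \<open>{ring, monoid_mult}\<close> is that of associative rings with identity; unlike
  \<open>ring_1\<close> it does not require \<open>0 \<noteq> 1\<close>.
\<close>

section \<open>Right modules\<close>

locale right_module =
  fixes act :: "'m::ab_group_add \<Rightarrow> 'r::{ring,monoid_mult} \<Rightarrow> 'm"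
  assumes act_add_left: "act (m + n) r = act m r + act n r"
    and act_add_right: "act m (r + s) = act m r + act m s"
    and act_mult: "act m (r * s) = act (act m r) s"
    and act_one: "act m 1 = m"

definition right_submodule :: "('m::ab_group_add \<Rightarrow> 'r \<Rightarrow> 'm) \<Rightarrow> 'm set \<Rightarrow> bool" where
  "right_submodule act N \<longleftrightarrow>
     0 \<in> N \<and> (\<forall>m\<in>N. \<forall>n\<in>N. m + n \<in> N) \<and> (\<forall>m\<in>N. - m \<in> N) \<and> (\<forall>m\<in>N. \<forall>r. act m r \<in> N)"

definition uniform_submodule :: "('m::ab_group_add \<Rightarrow> 'r \<Rightarrow> 'm) \<Rightarrow> 'm set \<Rightarrow> bool" where
  "uniform_submodule act N \<longleftrightarrow>
     right_submodule act N \<and> N \<noteq> {0} \<and>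
     (\<forall>K L. right_submodule act K \<and> K \<subseteq> N \<and> K \<noteq> {0} \<and> right_submodule act L \<and> L \<subseteq> N \<and> L \<noteq> {0}
        \<longrightarrow> K \<inter> L \<noteq> {0})"

section \<open>Skew Ore polynomial rings\<close>

locale ring_automorphism =
  fixes \<sigma> :: "'r::{ring,monoid_mult} \<Rightarrow> 'r"
  assumes aut_bij: "bij \<sigma>"
    and aut_add: "\<sigma> (r + s) = \<sigma> r + \<sigma> s"
    and aut_mult: "\<sigma> (r * s) = \<sigma> r * \<sigma> s"
    and aut_one: "\<sigma> 1 = 1"

locale skew_derivation =
  fixes \<sigma> :: "'r::{ring,monoid_mult} \<Rightarrow> 'r" and \<delta> :: "'r \<Rightarrow> 'r"
  assumes der_add: "\<delta> (r + s) = \<delta> r + \<delta> s"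
    and der_mult: "\<delta> (r * s) = \<sigma> r * \<delta> s + \<delta> r * s"

definition locally_nilpotent :: "('r::zero \<Rightarrow> 'r) \<Rightarrow> bool" where
  "locally_nilpotent \<delta> \<longleftrightarrow> (\<forall>r. \<exists>n\<ge>1. (\<delta> ^^ n) r = 0)"

text \<open>
  A finite family of coefficients \<open>r\<^sub>0, r\<^sub>1, \<dots>\<close> is stored as an element of \<^typ>\<open>'r poly\<close>; no
  multiplication of that type is used.
\<close>

definition ore_eval :: "('r::zero \<Rightarrow> 'a::{ring,monoid_mult}) \<Rightarrow> 'a \<Rightarrow> 'r poly \<Rightarrow> 'a" where
  "ore_eval \<iota> x q = (\<Sum>j\<le>degree q. \<iota> (coeff q j) * x ^ j)"

text \<open>
  \<open>skew_ore_ring \<sigma> \<delta> \<iota> x\<close>: the ring on the type \<open>'a\<close>, with \<open>'r\<close> embedded through \<open>\<iota>\<close> and the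
  distinguished element \<open>x\<close>, is \<open>R(x; \<sigma>, \<delta>)\<close>.  Injectivity of \<open>\<iota>\<close> follows from \<open>ore_unique_rep\<close>.
\<close>

locale skew_ore_ring =
  fixes \<sigma> \<delta> :: "'r::{ring,monoid_mult} \<Rightarrow> 'r"
    and \<iota> :: "'r \<Rightarrow> 'a::{ring,monoid_mult}" and x :: 'a
  assumes embed_add: "\<iota> (r + s) = \<iota> r + \<iota> s"
    and embed_mult: "\<iota> (r * s) = \<iota> r * \<iota> s"
    and embed_one: "\<iota> 1 = 1"
    and ore_unique_rep: "\<exists>!q. a = ore_eval \<iota> x q"
    and ore_commute: "x * \<iota> r = \<iota> (\<sigma> r) * x + x * \<iota> (\<delta> r) * x"

definition ore_coeffs :: "('r::zero \<Rightarrow> 'a::{ring,monoid_mult}) \<Rightarrow> 'a \<Rightarrow> 'a \<Rightarrow> 'r poly" where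
  "ore_coeffs \<iota> x a = (THE q. a = ore_eval \<iota> x q)"

section \<open>Inverse polynomial modules\<close>

definition inv_aut :: "('r \<Rightarrow> 'r) \<Rightarrow> 'r \<Rightarrow> 'r" where
  "inv_aut \<sigma> = inv \<sigma>"

definition inv_der :: "('r \<Rightarrow> 'r) \<Rightarrow> ('r \<Rightarrow> 'r) \<Rightarrow> 'r \<Rightarrow> 'r::uminus" where
  "inv_der \<sigma> \<delta> r = - \<delta> (inv \<sigma> r)"

text \<open>
  Words are boolean lists, \<open>True\<close> standing for \<open>\<sigma>'\<close> and \<open>False\<close> for \<open>\<delta>'\<close>; the head of the list is
  applied first.
\<close>

definition word_sum ::
  "('r::ab_group_add \<Rightarrow> 'r) \<Rightarrow> ('r \<Rightarrow> 'r) \<Rightarrow> nat \<Rightarrow> nat \<Rightarrow> 'r \<Rightarrow> 'r" where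
  "word_sum \<sigma> \<delta> k i r =
     (\<Sum>w | length w = k \<and> count_list w True = i.
        fold (\<lambda>b. if b then inv_aut \<sigma> else inv_der \<sigma> \<delta>) w r)"

text \<open>
  \<open>M[x\<^sup>-\<^sup>1]\<close> is the additive group of the type \<open>'m poly\<close>, \<open>coeff p i\<close> being the coefficient
  of \<open>x\<^sup>-\<^sup>i\<close>.
\<close>

definition inv_poly_act_base ::
  "('r::ab_group_add \<Rightarrow> 'r) \<Rightarrow> ('r \<Rightarrow> 'r) \<Rightarrow> ('m::ab_group_add \<Rightarrow> 'r \<Rightarrow> 'm)
     \<Rightarrow> 'm poly \<Rightarrow> 'r \<Rightarrow> 'm poly" where
  "inv_poly_act_base \<sigma> \<delta> act p r =
     (\<Sum>k\<le>degree p. \<Sum>i\<le>k. monom (act (coeff p k) (word_sum \<sigma> \<delta> k i r)) i)"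

text \<open>
  \<open>p (r\<^sub>0 + r\<^sub>1 x + \<dots>) = p r\<^sub>0 + (p r\<^sub>1) x + \<dots>\<close>, where \<open>poly_shift j\<close> is the action of \<open>x\<^sup>j\<close>: it
  lowers all indices by \<open>j\<close> and drops the coefficients of index below \<open>j\<close>.
\<close>

definition inv_poly_act ::
  "('r::{ring,monoid_mult} \<Rightarrow> 'r) \<Rightarrow> ('r \<Rightarrow> 'r) \<Rightarrow> ('r \<Rightarrow> 'a::{ring,monoid_mult}) \<Rightarrow> 'a
     \<Rightarrow> ('m::ab_group_add \<Rightarrow> 'r \<Rightarrow> 'm) \<Rightarrow> 'm poly \<Rightarrow> 'a \<Rightarrow> 'm poly" where
  "inv_poly_act \<sigma> \<delta> \<iota> x act p a =
     (let q = ore_coeffs \<iota> x a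
      in \<Sum>j\<le>degree q. poly_shift j (inv_poly_act_base \<sigma> \<delta> act p (coeff q j)))"

definition inv_polys :: "'m::zero set \<Rightarrow> 'm poly set" where
  "inv_polys N = {p. \<forall>i. coeff p i \<in> N}"


section \<open>\<open>M[x\<^sup>-\<^sup>1]\<close> is a right \<open>A\<close>-module\<close>

locale inv_poly_setting =
  ring_automorphism \<sigma> + skew_derivation \<sigma> \<delta> + skew_ore_ring \<sigma> \<delta> \<iota> x + right_module act
  for \<sigma> \<delta> :: "'r::{ring,monoid_mult} \<Rightarrow> 'r"
    and \<iota> :: "'r \<Rightarrow> 'a::{ring,monoid_mult}" and x :: 'a
    and act :: "'m::ab_group_add \<Rightarrow> 'r \<Rightarrow> 'm" +
  assumes nilp: "locally_nilpotent \<delta>"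
begin

abbreviation "tau \<equiv> inv_aut \<sigma>"
abbreviation "del \<equiv> inv_der \<sigma> \<delta>"
abbreviation "T \<equiv> inv_poly_act_base \<sigma> \<delta> act"
abbreviation "Act \<equiv> inv_poly_act \<sigma> \<delta> \<iota> x act"

lemma act_0 [simp]: "act 0 r = 0" "act m 0 = 0"
  using act_add_left[of 0 0 r] act_add_right[of m 0 0] by auto

lemma aut_0 [simp]: "\<sigma> 0 = 0" using aut_add[of 0 0] by simp
lemma der_0 [simp]: "\<delta> 0 = 0" using der_add[of 0 0] by simp
lemma embed_0 [simp]: "\<iota> 0 = 0" using embed_add[of 0 0] by simp

lemma embed_diff: "\<iota> (r - s) = \<iota> r - \<iota> s"
  using embed_add[of "r - s" s] by (simp add: algebra_simps)

lemma tau_aut [simp]: "tau (\<sigma> r) = r" "\<sigma> (tau r) = r"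
  using aut_bij by (simp_all add: inv_aut_def bij_is_inj bij_is_surj surj_f_inv_f)
lemma tau_add: "tau (r + s) = tau r + tau s"
  by (metis aut_add tau_aut)
lemma tau_mult: "tau (r * s) = tau r * tau s"
  by (metis aut_mult tau_aut)
lemma tau_one [simp]: "tau 1 = 1" by (metis aut_one tau_aut(1))
lemma tau_0 [simp]: "tau 0 = 0" by (metis aut_0 tau_aut(1))
lemma del_eq: "del r = - \<delta> (tau r)" by (simp add: inv_der_def inv_aut_def)
lemma del_add: "del (r + s) = del r + del s" by (simp add: del_eq tau_add der_add)
lemma del_0 [simp]: "del 0 = 0" by (simp add: del_eq)
lemma del_aut [simp]: "del (\<sigma> r) = - \<delta> r" by (simp add: del_eq)

lemma ore_eval_bound:
  assumes "degree q \<le> n"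
  shows "ore_eval \<iota> x q = (\<Sum>j\<le>n. \<iota> (coeff q j) * x ^ j)"
  unfolding ore_eval_def using assms
  by (intro sum.mono_neutral_left) (auto simp: coeff_eq_0)

lemma ore_eval_add: "ore_eval \<iota> x (p + q) = ore_eval \<iota> x p + ore_eval \<iota> x q"
proof -
  define n where "n = max (degree p) (degree q)"
  have "degree p \<le> n" "degree q \<le> n" "degree (p + q) \<le> n"
    by (auto simp: n_def degree_add_le)
  then show ?thesis
    by (simp add: ore_eval_bound[where n = n] embed_add distrib_right sum.distrib)
qed

lemma ore_eval_0 [simp]: "ore_eval \<iota> x 0 = 0" by (simp add: ore_eval_def)

lemma ore_eval_pCons: "ore_eval \<iota> x (pCons r q) = \<iota> r + ore_eval \<iota> x q * x"
proof -
  have "ore_eval \<iota> x (pCons r q) = (\<Sum>j\<le>Suc (degree q). \<iota> (coeff (pCons r q) j) * x ^ j)"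
    by (rule ore_eval_bound) (simp add: degree_pCons_le)
  also have "\<dots> = \<iota> r + (\<Sum>j\<le>degree q. \<iota> (coeff q j) * x ^ j * x)"
    by (subst sum.atMost_Suc_shift) (simp add: mult.assoc power_Suc2 del: power_Suc)
  finally show ?thesis by (simp add: ore_eval_def sum_distrib_right)
qed

lemma ore_coeffs_eval [simp]: "ore_coeffs \<iota> x (ore_eval \<iota> x q) = q"
  unfolding ore_coeffs_def using ore_unique_rep[of "ore_eval \<iota> x q"] by (intro the1_equality) auto

lemma ore_induct [case_names eval]:
  assumes "\<And>q. P (ore_eval \<iota> x q)" shows "P a"
  using ore_unique_rep[of a] assms by metis

lemma embed_eval: "\<iota> r = ore_eval \<iota> x [:r:]" by (simp add: ore_eval_pCons)

text \<open>
  The rule for \<open>x r\<close> makes \<open>\<delta>\<close> a \<open>(1, \<sigma>)\<close>-derivation, whereas \<open>skew_derivation\<close> is the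
  usual \<open>(\<sigma>, 1)\<close> convention.  Associativity of \<open>A\<close> forces both identities; the twisted Leibniz
  rule for \<open>\<delta>'\<close>, hence the module axioms below, depend on this one.
\<close>

lemma der_compatible: "r * \<delta> s + \<delta> r * \<sigma> s = \<delta> (r * s)"
proof -
  have rule: "x * \<iota> u = (\<iota> (\<sigma> u) + x * \<iota> (\<delta> u)) * x" for u
    using ore_commute[of u] by (simp add: distrib_right)
  have assc: "x * \<iota> (r * s) = x * \<iota> r * \<iota> s" by (simp add: embed_mult mult.assoc)
  have "x * \<iota> r * \<iota> s = \<iota> (\<sigma> r) * (x * \<iota> s) + x * \<iota> (\<delta> r) * (x * \<iota> s)"
    by (subst ore_commute[of r]) (simp add: algebra_simps)
  also have "\<dots> = \<iota> (\<sigma> r) * \<iota> (\<sigma> s) * x + (\<iota> (\<sigma> r) * x + x * \<iota> (\<delta> r) * x) * \<iota> (\<delta> s) * x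
      + x * \<iota> (\<delta> r) * \<iota> (\<sigma> s) * x"
    by (subst (1 2) ore_commute[of s]) (simp add: algebra_simps)
  also have "\<iota> (\<sigma> r) * x + x * \<iota> (\<delta> r) * x = x * \<iota> r" by (rule ore_commute[symmetric])
  finally have "x * \<iota> (\<delta> (r * s)) * x = x * \<iota> (r * \<delta> s + \<delta> r * \<sigma> s) * x"
    using ore_commute[of "r * s"] assc
    by (simp add: aut_mult embed_mult embed_add algebra_simps)
  moreover have canc: "u = 0" if "x * \<iota> u * x = 0" for u
  proof -
    define S where "S = (\<lambda>v. ore_coeffs \<iota> x (x * \<iota> v))"
    have Sc: "S v = pCons 0 ([:\<sigma> v:] + S (\<delta> v))" for v
    proof -
      have *: "x * \<iota> w = ore_eval \<iota> x (S w)" for w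
        unfolding S_def using ore_induct[of "\<lambda>a. a = ore_eval \<iota> x (ore_coeffs \<iota> x a)"] by simp
      have "x * \<iota> v = ore_eval \<iota> x (pCons 0 ([:\<sigma> v:] + S (\<delta> v)))"
        using rule[of v] by (simp add: ore_eval_pCons ore_eval_add *[symmetric])
      then show ?thesis by (simp add: S_def)
    qed
    have "x * \<iota> u * x = ore_eval \<iota> x (pCons 0 (S u))"
      unfolding S_def using ore_induct[of "\<lambda>a. a = ore_eval \<iota> x (ore_coeffs \<iota> x a)"]
      by (simp add: ore_eval_pCons)
    then have "ore_eval \<iota> x (pCons 0 (S u)) = ore_eval \<iota> x 0" using that by simp
    then have "pCons 0 (S u) = 0" by (metis ore_coeffs_eval)
    then have "coeff (S u) 1 = 0" by simp
    moreover have "coeff (S v) 0 = 0" for v by (simp add: Sc[of v])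
    ultimately have "\<sigma> u = 0" using Sc[of u] by simp
    then show "u = 0" by (metis tau_aut(1) tau_0)
  qed
  ultimately have "x * \<iota> (\<delta> (r * s) - (r * \<delta> s + \<delta> r * \<sigma> s)) * x = 0"
    by (simp only: embed_diff left_diff_distrib right_diff_distrib diff_self)
  from canc[OF this] show ?thesis by simp
qed

lemma del_mult: "del (r * s) = tau r * del s + del r * s"
  using der_compatible[of "tau r" "tau s", symmetric] by (simp add: del_eq tau_mult)

subsection \<open>The action of \<open>R\<close>\<close>

lemma word_sum_0 [simp]: "word_sum \<sigma> \<delta> 0 i r = (if i = 0 then r else 0)"
proof -
  have "{w. length w = 0 \<and> count_list w True = i} = (if i = 0 then {[]} else {})" by auto
  then show ?thesis by (simp only: word_sum_def) simp
qed

lemma word_sum_Suc: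
  "word_sum \<sigma> \<delta> (Suc k) i r =
     (case i of 0 \<Rightarrow> 0 | Suc i' \<Rightarrow> word_sum \<sigma> \<delta> k i' (tau r)) + word_sum \<sigma> \<delta> k i (del r)"
proof -
  let ?W = "\<lambda>k i. {w. length w = k \<and> count_list w True = i}"
  let ?f = "\<lambda>b. if b then tau else del"
  have fin: "finite (?W k i)" for k i
    by (rule finite_subset[OF _ finite_lists_length_eq[of UNIV k]]) auto
  have W: "?W (Suc k) i =
      (case i of 0 \<Rightarrow> {} | Suc i' \<Rightarrow> Cons True ` ?W k i') \<union> Cons False ` ?W k i"
    by (auto simp: length_Suc_conv image_iff split: nat.splits if_splits)
  show ?thesis
  proof (cases i)
    case 0
    have W0: "?W (Suc k) i = Cons False ` ?W k i" using W 0 by simp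
    show ?thesis unfolding word_sum_def W0
      by (subst sum.reindex) (auto simp: 0)
  next
    case (Suc i')
    have W1: "?W (Suc k) i = Cons True ` ?W k i' \<union> Cons False ` ?W k i" using W Suc by simp
    show ?thesis unfolding word_sum_def W1
      by (subst sum.union_disjoint)
        (use fin in \<open>auto simp: Suc sum.reindex\<close>)
  qed
qed

lemma T_bound:
  assumes "degree p \<le> n"
  shows "T p r = (\<Sum>k\<le>n. \<Sum>i\<le>k. monom (act (coeff p k) (word_sum \<sigma> \<delta> k i r)) i)"
  unfolding inv_poly_act_base_def using assms
  by (intro sum.mono_neutral_left) (auto simp: coeff_eq_0)

lemma word_sum_gt: "k < i \<Longrightarrow> word_sum \<sigma> \<delta> k i r = 0"
  by (induction k arbitrary: i r) (auto simp: word_sum_Suc split: nat.splits)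

lemma coeff_T:
  assumes "degree p \<le> n"
  shows "coeff (T p r) i = (\<Sum>k\<le>n. act (coeff p k) (word_sum \<sigma> \<delta> k i r))"
proof -
  have "coeff (T p r) i = (\<Sum>k\<le>n. \<Sum>i'\<le>k. if i' = i then act (coeff p k) (word_sum \<sigma> \<delta> k i r) else 0)"
    by (simp add: T_bound[OF assms] coeff_sum if_distrib cong: if_cong)
  also have "\<dots> = (\<Sum>k\<le>n. act (coeff p k) (word_sum \<sigma> \<delta> k i r))"
    by (intro sum.cong refl) (auto simp: sum.delta word_sum_gt)
  finally show ?thesis .
qed

lemma T_0 [simp]: "T 0 r = 0" by (simp add: inv_poly_act_base_def)

lemma T_pCons: "T (pCons m p) r = pCons (act m r) (T p (tau r)) + T p (del r)"
proof (rule poly_eqI)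
  fix i
  have "degree (pCons m p) \<le> Suc (degree p)" by (rule degree_pCons_le)
  from coeff_T[OF this]
  have "coeff (T (pCons m p) r) i = act m (if i = 0 then r else 0)
      + (\<Sum>k\<le>degree p. act (coeff p k) (word_sum \<sigma> \<delta> (Suc k) i r))"
    by (subst (asm) sum.atMost_Suc_shift) simp
  also have "\<dots> = coeff (pCons (act m r) (T p (tau r)) + T p (del r)) i"
    by (cases i) (simp_all add: word_sum_Suc coeff_T[OF order_refl] act_add_right sum.distrib)
  finally show "coeff (T (pCons m p) r) i = coeff (pCons (act m r) (T p (tau r)) + T p (del r)) i" .
qed

lemma T_add_left: "T (p + q) r = T p r + T q r"
proof (rule poly_eqI)
  fix i
  define n where "n = max (degree p) (degree q)"
  have "degree p \<le> n" "degree q \<le> n" "degree (p + q) \<le> n"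
    by (auto simp: n_def degree_add_le)
  then show "coeff (T (p + q) r) i = coeff (T p r + T q r) i"
    by (simp add: coeff_T[where n = n] act_add_left sum.distrib)
qed

lemma T_add_right: "T p (r + s) = T p r + T p s"
  by (induction p arbitrary: r s) (simp_all add: T_pCons act_add_right tau_add del_add algebra_simps)

lemma T_zero_right [simp]: "T p 0 = 0"
  using T_add_right[of p 0 0] by simp

lemma T_uminus_right: "T p (- r) = - T p r"
  using T_add_right[of p r "- r"] by (simp add: eq_neg_iff_add_eq_0 add.commute)

lemma del_one [simp]: "del 1 = 0"
  using del_mult[of 1 1] by simp

lemma T_one: "T p 1 = p"
  by (induction p) (simp_all add: T_pCons act_one)

lemma T_mult: "T p (r * s) = T (T p r) s"
proof (induction p arbitrary: r s)
  case (pCons m p)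
  then show ?case
    by (simp add: T_pCons T_add_left act_mult tau_mult del_mult T_add_right add_ac flip: pCons.IH)
qed simp

abbreviation "sh \<equiv> poly_shift (Suc 0)"

lemma sh_add: "sh (p + q) = sh p + sh q"
  by (simp add: poly_eq_iff coeff_poly_shift)

lemma sh_pCons [simp]: "sh (pCons m p) = p"
  by (simp add: poly_eq_iff coeff_poly_shift)

lemma shift_Suc: "sh (poly_shift j p) = poly_shift (Suc j) p"
  by (simp add: poly_eq_iff coeff_poly_shift)

lemma shift_add: "poly_shift j (p + q) = poly_shift j p + poly_shift j q"
  by (simp add: poly_eq_iff coeff_poly_shift)

lemma sh_sum: "sh (sum f A) = (\<Sum>a\<in>A. sh (f a))"
  by (simp add: poly_eq_iff coeff_poly_shift coeff_sum)

lemma sh_T: "sh (T p (\<sigma> r)) + sh (T (sh p) (\<delta> r)) = T (sh p) r"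
proof (cases p)
  case (pCons m q)
  have "sh (u - v) = sh u - sh v" for u v :: "'m poly"
    by (simp add: poly_eq_iff coeff_poly_shift)
  then show ?thesis by (simp add: pCons T_pCons T_uminus_right)
qed

subsection \<open>The action of \<open>A\<close>\<close>

lemma Act_bound:
  assumes "degree q \<le> n"
  shows "Act p (ore_eval \<iota> x q) = (\<Sum>j\<le>n. poly_shift j (T p (coeff q j)))"
  unfolding inv_poly_act_def Let_def ore_coeffs_eval using assms
  by (intro sum.mono_neutral_left) (auto simp: coeff_eq_0)

lemma Act_add_left: "Act (p + p') a = Act p a + Act p' a"
  by (simp add: inv_poly_act_def Let_def T_add_left shift_add sum.distrib)

lemma Act_add_right: "Act p (a + b) = Act p a + Act p b"
proof (induction a rule: ore_induct)
  case (eval q)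
  show ?case
  proof (induction b rule: ore_induct)
    case (eval q')
    define n where "n = max (degree q) (degree q')"
    have "degree q \<le> n" "degree q' \<le> n" "degree (q + q') \<le> n"
      by (auto simp: n_def degree_add_le)
    then show ?case
      by (simp flip: ore_eval_add
          add: Act_bound[where n = n] T_add_right shift_add sum.distrib)
  qed
qed

lemma Act_embed: "Act p (\<iota> r) = T p r"
  by (simp add: embed_eval Act_bound[where n = 0])

lemma Act_x: "Act p (a * x) = sh (Act p a)"
proof (induction a rule: ore_induct)
  case (eval q)
  have "ore_eval \<iota> x q * x = ore_eval \<iota> x (pCons 0 q)" by (simp add: ore_eval_pCons)
  then have "Act p (ore_eval \<iota> x q * x)
      = (\<Sum>j\<le>Suc (degree q). poly_shift j (T p (coeff (pCons 0 q) j)))"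
    by (simp only: Act_bound[OF degree_pCons_le])
  also have "\<dots> = (\<Sum>j\<le>degree q. sh (poly_shift j (T p (coeff q j))))"
    by (subst sum.atMost_Suc_shift) (simp add: shift_Suc)
  finally show ?case by (simp add: Act_bound[OF order_refl] sh_sum)
qed

lemma Act_mult_embed_monom: "Act p (\<iota> r * x ^ j * \<iota> s) = T (Act p (\<iota> r * x ^ j)) s"
proof (induction j arbitrary: s)
  case 0
  show ?case by (simp add: Act_embed T_mult flip: embed_mult)
next
  case (Suc j)
  have *: "\<iota> r * x ^ Suc j * \<iota> s
      = (\<iota> r * x ^ j * \<iota> (\<sigma> s)) * x + (\<iota> r * x ^ Suc j * \<iota> (\<delta> s)) * x" for s
  proof -
    have "\<iota> r * x ^ Suc j * \<iota> s = \<iota> r * x ^ j * (x * \<iota> s)"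
      by (simp only: power_Suc2 mult.assoc)
    also have "\<dots> = \<iota> r * x ^ j * (\<iota> (\<sigma> s) * x) + \<iota> r * x ^ j * (x * \<iota> (\<delta> s) * x)"
      by (subst ore_commute) (simp only: distrib_left)
    finally show ?thesis by (simp only: power_Suc2 mult.assoc)
  qed
  have shj: "Act p (\<iota> r * x ^ Suc j) = sh (Act p (\<iota> r * x ^ j))"
    by (simp only: power_Suc2 mult.assoc[symmetric] Act_x)
  have "\<forall>s. (\<delta> ^^ n) s = 0 \<longrightarrow> Act p (\<iota> r * x ^ Suc j * \<iota> s) = T (Act p (\<iota> r * x ^ Suc j)) s" for n
  proof (induction n)
    case 0
    have "Act p 0 = 0" using Act_add_right[of p 0 0] by simp
    then show ?case by simp
  next
    case (Suc n)
    show ?case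
    proof (intro allI impI)
      fix s assume "(\<delta> ^^ Suc n) s = 0"
      then have "(\<delta> ^^ n) (\<delta> s) = 0" by (simp add: funpow_swap1)
      with Suc have IH: "Act p (\<iota> r * x ^ Suc j * \<iota> (\<delta> s)) = T (Act p (\<iota> r * x ^ Suc j)) (\<delta> s)"
        by blast
      show "Act p (\<iota> r * x ^ Suc j * \<iota> s) = T (Act p (\<iota> r * x ^ Suc j)) s"
        unfolding *[of s] Act_add_right Act_x IH Suc.IH \<open>\<And>s. Act p (\<iota> r * x ^ j * \<iota> s) = T (Act p (\<iota> r * x ^ j)) s\<close>
        unfolding shj by (rule sh_T)
    qed
  qed
  moreover obtain n where "(\<delta> ^^ n) s = 0" using nilp by (auto simp: locally_nilpotent_def)
  ultimately show ?case by blast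
qed

lemma Act_zero [simp]: "Act p 0 = 0" using Act_add_right[of p 0 0] by simp

lemma Act_sum: "Act p (sum f B) = (\<Sum>b\<in>B. Act p (f b))"
  by (induction B rule: infinite_finite_induct) (simp_all add: Act_add_right)

lemma T_sum: "T (sum f B) s = (\<Sum>b\<in>B. T (f b) s)"
  by (induction B rule: infinite_finite_induct) (simp_all add: T_add_left)

lemma Act_mult_embed: "Act p (a * \<iota> s) = T (Act p a) s"
  by (induction a rule: ore_induct)
    (simp add: ore_eval_def sum_distrib_right Act_sum T_sum Act_mult_embed_monom)

lemma Act_mult: "Act p (a * b) = Act (Act p a) b"
proof (induction b rule: ore_induct)
  case (eval q)
  have *: "Act p (a * (\<iota> r * x ^ j)) = Act (Act p a) (\<iota> r * x ^ j)" for r j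
  proof (induction j)
    case 0
    show ?case by (simp add: Act_mult_embed Act_embed)
  next
    case (Suc j)
    then show ?case by (simp only: power_Suc2 mult.assoc[symmetric] Act_x)
  qed
  show ?case by (simp add: ore_eval_def sum_distrib_left Act_sum *)
qed

theorem right_module_inv_poly: "right_module Act"
  by standard
    (simp_all add: Act_add_left Act_add_right Act_mult Act_embed T_one flip: embed_one)

lemma inv_poly_act_embed:
  "Act (monom m k) (\<iota> r) = (\<Sum>i\<le>k. monom (act m (word_sum \<sigma> \<delta> k i r)) i)"
proof (cases "m = 0")
  case False
  then have "Act (monom m k) (\<iota> r)
      = (\<Sum>k'\<le>k. \<Sum>i\<le>k'. monom (act (if k = k' then m else 0) (word_sum \<sigma> \<delta> k' i r)) i)"
    by (simp add: Act_embed inv_poly_act_base_def degree_monom_eq coeff_monom)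
  also have "\<dots> = (\<Sum>k'\<le>k. if k' = k then (\<Sum>i\<le>k. monom (act m (word_sum \<sigma> \<delta> k i r)) i) else 0)"
    by (intro sum.cong refl) auto
  finally show ?thesis by simp
qed (simp add: Act_embed)

lemma inv_poly_act_power:
  "Act (monom m i) (x ^ j) = (if j \<le> i then monom m (i - j) else 0)"
proof -
  have "Act p (x ^ j) = poly_shift j p" for p
  proof (induction j)
    case 0
    show ?case by (simp add: Act_embed T_one flip: embed_one)
  next
    case (Suc j)
    then show ?case by (simp only: power_Suc2 Act_x shift_Suc)
  qed
  then show ?thesis by (simp add: poly_shift_monom)
qed

end

end

theory Submission
  imports Defs
begin

text \<open>
  Acting on a non-zero inverse polynomial of degree \<open>k\<close> by \<open>x\<^sup>k\<close> leaves its leading coefficient.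
  Hence the constants of a non-zero \<open>A\<close>-submodule of \<open>N[x\<^sup>-\<^sup>1]\<close> form a non-zero \<open>R\<close>-submodule
  of \<open>N\<close>, and two such meet because \<open>N\<close> is uniform.
\<close>

lemma right_submodule_sum:
  assumes "right_submodule act N" and "\<And>i. i \<in> I \<Longrightarrow> f i \<in> N"
  shows "sum f I \<in> N"
  using assms(2)
  by (induction I rule: infinite_finite_induct) (use assms(1) in \<open>auto simp: right_submodule_def\<close>)

text \<open>The empty set also differs from \<open>{0}\<close>; membership of \<open>0\<close> in a
  submodule rules it out.\<close>

lemma right_submodule_nonzeroE:
  assumes "right_submodule act N" and "N \<noteq> {0}"
  obtains m where "m \<in> N" and "m \<noteq> 0"
  using assms unfolding right_submodule_def by blast

context inv_poly_setting
begin

text \<open>By \<open>coeff_T\<close>, a coefficient of \<open>T p r\<close> is a finite sum of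
  values \<open>act (coeff p k) _\<close>, all in \<open>N\<close>. A general element of the ring
  acts by sums of shifts of such polynomials, and shifting only re-indexes coefficients.\<close>

lemma inv_polys_submodule:
  assumes N: "right_submodule act N"
  shows "right_submodule Act (inv_polys N)"
proof -
  have T_mem: "coeff (T p r) i \<in> N" if "p \<in> inv_polys N" for p r i
    unfolding coeff_T[OF order_refl] using N that
    by (intro right_submodule_sum[OF N]) (auto simp: right_submodule_def inv_polys_def)
  have "coeff (Act p a) i \<in> N" if "p \<in> inv_polys N" for p a i
    unfolding inv_poly_act_def Let_def coeff_sum coeff_poly_shift
    by (intro right_submodule_sum[OF N] T_mem that)
  then show ?thesis
    using N by (auto simp: right_submodule_def inv_polys_def)
qed

lemma Act_const_embed: "Act [:m:] (\<iota> r) = [:act m r:]"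
  by (simp add: Act_embed T_pCons)

lemma Act_shift: "Act p x = sh p"
  using Act_x[of p 1] Act_embed[of p 1] by (simp add: embed_one T_one)

text \<open>Each action of \<open>x\<close> strips the constant term, turning
  \<open>pCons m q\<close> into \<open>q\<close>, so induction over \<open>pCons\<close> reaches the
  leading coefficient without tracking the degree. At \<open>q = 0\<close>, the polynomial being
  non-zero forces \<open>m \<noteq> 0\<close>.\<close>

lemma submodule_nonzero_const:
  assumes "right_submodule Act K" and "p \<in> K" and "p \<noteq> 0"
  shows "\<exists>m. m \<noteq> 0 \<and> [:m:] \<in> K"
  using assms(2,3)
proof (induction p)
  case (pCons m q)
  show ?case
  proof (cases "q = 0")
    case True
    then show ?thesis using pCons.prems by auto
  next
    case False
    have "Act (pCons m q) x \<in> K"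
      using assms(1) pCons.prems(1) by (simp add: right_submodule_def)
    with False show ?thesis using pCons.IH by (simp add: Act_shift)
  qed
qed simp

text \<open>The map from \<open>m\<close> to \<open>[:m:]\<close> is additive and, by
  \<open>Act_const_embed\<close>, compatible with the action of scalars; the set is the preimage of
  \<open>K\<close> under it.\<close>

lemma submodule_consts:
  assumes "right_submodule Act K"
  shows "right_submodule act {m. [:m:] \<in> K}"
  unfolding right_submodule_def
proof (intro conjI ballI allI; clarsimp)
  note K = assms[unfolded right_submodule_def]
  show "0 \<in> K" using K by blast
  show "[:m + n:] \<in> K" if "[:m:] \<in> K" "[:n:] \<in> K" for m n
    using K that by (metis add_pCons add_0_left)
  show "[:- m:] \<in> K" if "[:m:] \<in> K" for m
    using K that by (metis minus_pCons minus_zero)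
  show "[:act m r:] \<in> K" if "[:m:] \<in> K" for m r
    using K that by (metis Act_const_embed)
qed

lemma submodule_consts_nonzero:
  assumes "right_submodule Act K" and "K \<noteq> {0}"
  shows "{m. [:m:] \<in> K} \<noteq> {0}"
  using right_submodule_nonzeroE[OF assms] submodule_nonzero_const[OF assms(1)] by blast

lemma inv_polys_uniform:
  assumes "uniform_submodule act N"
  shows "uniform_submodule Act (inv_polys N)"
  unfolding uniform_submodule_def
proof (intro conjI allI impI)
  have N: "right_submodule act N" and "N \<noteq> {0}"
    using assms by (simp_all add: uniform_submodule_def)
  show "right_submodule Act (inv_polys N)" by (rule inv_polys_submodule[OF N])
  obtain m where m: "m \<in> N" "m \<noteq> 0"
    using right_submodule_nonzeroE[OF N \<open>N \<noteq> {0}\<close>] .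
  then have "[:m:] \<in> inv_polys N"
    using N by (auto simp: inv_polys_def right_submodule_def coeff_pCons split: nat.splits)
  with m show "inv_polys N \<noteq> {0}" by (metis pCons_eq_0_iff singletonD)
next
  fix K L
  assume KL: "right_submodule Act K \<and> K \<subseteq> inv_polys N \<and> K \<noteq> {0} \<and>
    right_submodule Act L \<and> L \<subseteq> inv_polys N \<and> L \<noteq> {0}"
  \<comment> \<open>The coefficient of \<open>[:m:]\<close> at index 0 is \<open>m\<close>
    itself.\<close>
  have consts_subset: "{m. [:m:] \<in> J} \<subseteq> N" if "J \<subseteq> inv_polys N" for J
    using that by (force simp: inv_polys_def dest: spec[of _ 0])
  have "{m. [:m:] \<in> K} \<inter> {m. [:m:] \<in> L} \<noteq> {0}"
    using assms KL by (simp add: uniform_submodule_def submodule_consts submodule_consts_nonzero consts_subset)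
  \<comment> \<open>Since \<open>[:0:] = 0\<close>, this shows that the two sets of constants share
    \<open>0\<close>; their intersection is thus non-empty and, not being \<open>{0}\<close>,
    contains a non-zero element.\<close>
  moreover have "0 \<in> K \<inter> L" using KL by (simp add: right_submodule_def)
  ultimately obtain m where "m \<noteq> 0" "[:m:] \<in> K \<inter> L" by force
  then show "K \<inter> L \<noteq> {0}" by (metis pCons_eq_0_iff singletonD)
qed

end

theorem lemma3p2:
  fixes \<sigma> \<delta> :: "'r::{ring,monoid_mult} \<Rightarrow> 'r"
    and \<iota> :: "'r \<Rightarrow> 'a::{ring,monoid_mult}" and x :: 'a
    and act :: "'m::ab_group_add \<Rightarrow> 'r \<Rightarrow> 'm" and N :: "'m set"
  assumes "ring_automorphism \<sigma>"
    and "skew_derivation \<sigma> \<delta>"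
    and "locally_nilpotent \<delta>"
    and "skew_ore_ring \<sigma> \<delta> \<iota> x"
    and "right_module act"
    and "uniform_submodule act N"
  shows "uniform_submodule (inv_poly_act \<sigma> \<delta> \<iota> x act) (inv_polys N)"
proof -
  interpret inv_poly_setting \<sigma> \<delta> \<iota> x act
    using assms by (intro inv_poly_setting.intro inv_poly_setting_axioms.intro)
  show ?thesis by (rule inv_polys_uniform[OF assms(6)])
qed

end
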